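(* Let $G$ be an automatic group, $L_1$ be an automatic structure for $\pi_1:A^*\to G$ admitting a departure function, $L_2$ be an automatic structure for $\pi_2:B^*\to G$, and $\varphi\in\mathrm{End}(G)$. If the FT-BRP holds for $(\varphi,L_1,L_2)$, then so does the BRP.
   Context: Maps are written on the right. Let $A$ be a finite alphabet and $\pi:A^*\to G$ a surjective (monoid) homomorphism onto a group $G$. $d_A$ denotes the geodesic (word) metric on the Cayley graph $\Gamma_A(G)$ of $G$ with respect to $A\pi$. For a word $u$, $u^{[n]}$ is its prefix with $n$ letters, and $u^{[n]}=u$ if $n>|u|$. An automatic structure for $\pi$ is a rational (regular) language $L\subseteq A^*$ with $L\pi=G$ such that there is $N\in\mathbb N$ for which all $u,v\in L$ with $d_A(u\pi,v\pi)\le 1$ satisfy $d_A(u^{[n]}\pi,v^{[n]}\pi)\le N$ for all $n\in\mathbb N$ (equivalent to the definition by finite state multiplier automata). A departure function for $(G,L)$ is a function $D:\mathbb R_{\ge0}\to\mathbb R_{\ge 0}$ such that if $w\in L$, $r,s\ge0$, $t\ge D(r)$ and $s+t\le|w|$, then $d_A(w^{[s]}\pi,w^{[s+t]}\pi)>r$ (with $s,t$ integers). Words $u,v\in A^*$ $p$-fellow travel in $\Gamma_A(G)$ if $d_A(u^{[n]}\pi,v^{[n]}\pi)\le p$ for all $n\in\mathbb N$; they are $p$-MFT (meeting fellow travellers) if moreover $u\pi=v\pi$. FT-BRP: the FT-BRP holds for $(\varphi,L_1,L_2)$ if for every $p\ge 0$ there is $q\ge0$ such that: whenever $u_i\in L_1$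 and $u_i'\in L_2$ with $u_i'\pi_2=u_i\pi_1\varphi$ for $i=1,2,3$, if $u_1u_2$ and $u_3$ are $p$-MFT in $\Gamma_A(G)$, then $u_1'u_2'$ and $u_3'$ are $q$-MFT in $\Gamma_B(G)$. BRP: for a word $u$ and $x\in G$ let $\theta_u^x:\{0,\dots,|u|\}\to G$, $n\mapsto x(u^{[n]}\pi)$ ($\pi$ the relevant homomorphism). The BRP holds for $(\varphi,L_1,L_2)$ if there is $N>0$ such that $\mathrm{Haus}(\mathrm{Im}(\theta_\alpha^x\varphi),\mathrm{Im}(\theta_\beta^{x\varphi}))\le N$ for all $x\in G$, $\alpha\in L_1$, $\beta\in L_2$ with $\beta\pi_2=\alpha\pi_1\varphi$, where $\mathrm{Haus}$ is Hausdorff distance with respect to a word metric of a finite generating set (the choice is irrelevant). *)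

theory Defs
  imports Complex_Main "HOL-Algebra.Generated_Groups" "HOL-Library.Extended_Real"
begin

text \<open>
  Maps are written on the left here, so \<open>u\<pi>\<close> becomes \<open>\<pi> u\<close>. The prefix \<open>u\<^sup>[\<^sup>n\<^sup>]\<close> is
  \<open>take n u\<close>, which equals \<open>u\<close> when \<open>n\<close> exceeds the length of \<open>u\<close>.
\<close>

definition free_monoid :: "'a set \<Rightarrow> 'a list monoid" where
  "free_monoid A = \<lparr>carrier = lists A, mult = (@), one = []\<rparr>"

inductive rational :: "'a set \<Rightarrow> 'a list set \<Rightarrow> bool" for A where
  empty: "rational A {}"
| eps: "rational A {[]}"
| letter: "a \<in> A \<Longrightarrow> rational A {[a]}"
| union: "rational A K \<Longrightarrow> rational A L \<Longrightarrow> rational A (K \<union> L)"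
| product: "rational A K \<Longrightarrow> rational A L \<Longrightarrow> rational A {u @ v | u v. u \<in> K \<and> v \<in> L}"
| star: "rational A K \<Longrightarrow> rational A {concat us | us. set us \<subseteq> K}"

definition cayley_edges :: "('g, 'm) monoid_scheme \<Rightarrow> 'g set \<Rightarrow> ('g \<times> 'g) set" where
  "cayley_edges G S = {(g, g \<otimes>\<^bsub>G\<^esub> s) | g s. g \<in> carrier G \<and> s \<in> S}"

text \<open>
  Paths may traverse edges in either direction: \<open>S\<close> is not assumed closed under inverses, and
  without this the distance would not be symmetric. The value is meaningful for elements of
  \<open>carrier G\<close> when \<open>S\<close> generates \<open>G\<close>, so that a path exists.
\<close>

definition word_dist :: "('g, 'm) monoid_scheme \<Rightarrow> 'g set \<Rightarrow> 'g \<Rightarrow> 'g \<Rightarrow> nat" where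
  "word_dist G S g h =
     (LEAST n. (g, h) \<in> (cayley_edges G S \<union> (cayley_edges G S)\<inverse>) ^^ n)"

definition geod_dist ::
  "('g, 'm) monoid_scheme \<Rightarrow> 'a set \<Rightarrow> ('a list \<Rightarrow> 'g) \<Rightarrow> 'g \<Rightarrow> 'g \<Rightarrow> nat" where
  "geod_dist G A \<pi> = word_dist G ((\<lambda>a. \<pi> [a]) ` A)"

definition automatic_structure ::
  "('g, 'm) monoid_scheme \<Rightarrow> 'a set \<Rightarrow> ('a list \<Rightarrow> 'g) \<Rightarrow> 'a list set \<Rightarrow> bool" where
  "automatic_structure G A \<pi> L \<longleftrightarrow>
     rational A L \<and> \<pi> ` L = carrier G \<and>
     (\<exists>N::nat. \<forall>u\<in>L. \<forall>v\<in>L. geod_dist G A \<pi> (\<pi> u) (\<pi> v) \<le> 1 \<longrightarrow>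
        (\<forall>n. geod_dist G A \<pi> (\<pi> (take n u)) (\<pi> (take n v)) \<le> N))"

text \<open>Only the values of \<open>D\<close> on nonnegative reals matter.\<close>

definition departure_function ::
  "('g, 'm) monoid_scheme \<Rightarrow> 'a set \<Rightarrow> ('a list \<Rightarrow> 'g) \<Rightarrow> 'a list set \<Rightarrow> (real \<Rightarrow> real) \<Rightarrow> bool" where
  "departure_function G A \<pi> L D \<longleftrightarrow>
     (\<forall>r\<ge>0. D r \<ge> 0) \<and>
     (\<forall>w\<in>L. \<forall>r\<ge>0. \<forall>s t :: nat. real t \<ge> D r \<and> s + t \<le> length w \<longrightarrow>
        real (geod_dist G A \<pi> (\<pi> (take s w)) (\<pi> (take (s + t) w))) > r)"

definition fellow_travel ::
  "('g, 'm) monoid_scheme \<Rightarrow> 'a set \<Rightarrow> ('a list \<Rightarrow> 'g) \<Rightarrow> real \<Rightarrow> 'a list \<Rightarrow> 'a list \<Rightarrow> bool" where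
  "fellow_travel G A \<pi> p u v \<longleftrightarrow>
     (\<forall>n. real (geod_dist G A \<pi> (\<pi> (take n u)) (\<pi> (take n v))) \<le> p)"

definition MFT ::
  "('g, 'm) monoid_scheme \<Rightarrow> 'a set \<Rightarrow> ('a list \<Rightarrow> 'g) \<Rightarrow> real \<Rightarrow> 'a list \<Rightarrow> 'a list \<Rightarrow> bool" where
  "MFT G A \<pi> p u v \<longleftrightarrow> fellow_travel G A \<pi> p u v \<and> \<pi> u = \<pi> v"

definition FT_BRP ::
  "('g, 'm) monoid_scheme \<Rightarrow> 'a set \<Rightarrow> ('a list \<Rightarrow> 'g) \<Rightarrow> 'b set \<Rightarrow> ('b list \<Rightarrow> 'g) \<Rightarrow>
   ('g \<Rightarrow> 'g) \<Rightarrow> 'a list set \<Rightarrow> 'b list set \<Rightarrow> bool" where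
  "FT_BRP G A \<pi>\<^sub>1 B \<pi>\<^sub>2 \<phi> L\<^sub>1 L\<^sub>2 \<longleftrightarrow>
     (\<forall>p\<ge>0. \<exists>q\<ge>0. \<forall>u\<^sub>1\<in>L\<^sub>1. \<forall>u\<^sub>2\<in>L\<^sub>1. \<forall>u\<^sub>3\<in>L\<^sub>1. \<forall>v\<^sub>1\<in>L\<^sub>2. \<forall>v\<^sub>2\<in>L\<^sub>2. \<forall>v\<^sub>3\<in>L\<^sub>2.
        \<pi>\<^sub>2 v\<^sub>1 = \<phi> (\<pi>\<^sub>1 u\<^sub>1) \<and> \<pi>\<^sub>2 v\<^sub>2 = \<phi> (\<pi>\<^sub>1 u\<^sub>2) \<and> \<pi>\<^sub>2 v\<^sub>3 = \<phi> (\<pi>\<^sub>1 u\<^sub>3) \<and>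
        MFT G A \<pi>\<^sub>1 p (u\<^sub>1 @ u\<^sub>2) u\<^sub>3 \<longrightarrow> MFT G B \<pi>\<^sub>2 q (v\<^sub>1 @ v\<^sub>2) v\<^sub>3)"

definition \<theta> :: "('g, 'm) monoid_scheme \<Rightarrow> ('a list \<Rightarrow> 'g) \<Rightarrow> 'g \<Rightarrow> 'a list \<Rightarrow> nat \<Rightarrow> 'g" where
  "\<theta> G \<pi> x u n = x \<otimes>\<^bsub>G\<^esub> \<pi> (take n u)"

definition hausdorff_dist :: "('g \<Rightarrow> 'g \<Rightarrow> real) \<Rightarrow> 'g set \<Rightarrow> 'g set \<Rightarrow> ereal" where
  "hausdorff_dist d X Y =
     max (SUP x\<in>X. INF y\<in>Y. ereal (d x y)) (SUP y\<in>Y. INF x\<in>X. ereal (d x y))"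

text \<open>
  The Hausdorff distance may be taken with respect to the word metric of any finite generating set
  of \<open>G\<close>. Word metrics of finite generating sets are bi-Lipschitz equivalent, so the choice does
  not matter; the definition asks for a bound for each choice.
\<close>

definition BRP ::
  "('g, 'm) monoid_scheme \<Rightarrow> ('a list \<Rightarrow> 'g) \<Rightarrow> ('b list \<Rightarrow> 'g) \<Rightarrow>
   ('g \<Rightarrow> 'g) \<Rightarrow> 'a list set \<Rightarrow> 'b list set \<Rightarrow> bool" where
  "BRP G \<pi>\<^sub>1 \<pi>\<^sub>2 \<phi> L\<^sub>1 L\<^sub>2 \<longleftrightarrow>
     (\<forall>S. finite S \<and> S \<subseteq> carrier G \<and> generate G S = carrier G \<longrightarrow>
       (\<exists>N::real. N > 0 \<and>
         (\<forall>x\<in>carrier G. \<forall>\<alpha>\<in>L\<^sub>1. \<forall>\<beta>\<in>L\<^sub>2. \<pi>\<^sub>2 \<beta> = \<phi> (\<pi>\<^sub>1 \<alpha>) \<longrightarrow>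
            hausdorff_dist (\<lambda>g h. real (word_dist G S g h))
              ((\<phi> \<circ> \<theta> G \<pi>\<^sub>1 x \<alpha>) ` {0..length \<alpha>}) (\<theta> G \<pi>\<^sub>2 (\<phi> x) \<beta> ` {0..length \<beta>}) \<le> ereal N)))"

end

theory Submission
  imports Defs
begin

text \<open>
  Fix \<open>\<alpha> \<in> L\<^sub>1\<close> and \<open>\<beta> \<in> L\<^sub>2\<close> with \<open>\<pi>\<^sub>2 \<beta> = \<phi> (\<pi>\<^sub>1 \<alpha>)\<close>. Word metrics are left invariant, so the
  translation by \<open>x\<close> is harmless, and changing the finite generating set costs a constant factor
  (\<open>hom_lipschitz\<close>). It remains to compare the prefixes of \<open>\<alpha>\<close>, mapped by \<open>\<phi>\<close>, with those of \<open>\<beta>\<close>.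

  Cut \<open>\<alpha> = ab\<close>. Neither \<open>a\<close> nor \<open>b\<close> need lie in \<open>L\<^sub>1\<close>, but rationality gives words \<open>w\<close> and \<open>z\<close> of
  bounded length with \<open>aw \<in> L\<^sub>1\<close> and \<open>zb \<in> L\<^sub>1\<close>. Let \<open>u \<in> L\<^sub>1\<close> represent \<open>a z\<inverse>\<close>. Then \<open>u\<close> and \<open>aw\<close>
  end close together, so they fellow travel; the departure function forces their lengths to differ
  by a bounded amount, since a much longer word would linger near the end of the shorter one.
  Hence \<open>u\<close> followed by \<open>zb\<close> and \<open>\<alpha>\<close> are meeting fellow travellers with a uniform constant
  (\<open>split_into_language_words\<close>). The FT-BRP now yields \<open>v \<in> L\<^sub>2\<close> which ends near
  \<open>\<phi> (\<pi>\<^sub>1 a)\<close> and fellow travels with \<open>\<beta>\<close> for as long as \<open>v\<close> lasts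
  (\<open>shadowing_words_exist\<close>). In particular \<open>\<phi> (\<pi>\<^sub>1 a)\<close> is near \<open>\<beta>\<close>.

  For the converse, nothing prevents \<open>\<beta>\<close> from wandering between the times at which it is known to
  be near \<open>\<phi>\<close>-images. Instead the shadowing words of all prefixes are lined up, from a fixed word
  for the identity to \<open>\<beta>\<close> itself. Consecutive ones end close together, so they fellow travel. At
  time \<open>m\<close>, take the first word in the chain that has not ended yet: \<open>\<beta>\<close> is near that word at time
  \<open>m\<close>, which is near its predecessor at time \<open>m\<close>, and the predecessor has already stopped near a
  \<open>\<phi>\<close>-image (\<open>chain_of_shadows\<close>).
\<close>

section \<open>Word metrics\<close>

locale generating_set = group G for G (structure) +
  fixes S :: "'a set"
  assumes gens_closed: "S \<subseteq> carrier G"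
    and gens_generate: "generate G S = carrier G"
begin

abbreviation adjacent :: "('a \<times> 'a) set" where
  "adjacent \<equiv> cayley_edges G S \<union> (cayley_edges G S)\<inverse>"

lemma adjacent_closed: "(g, h) \<in> adjacent \<Longrightarrow> g \<in> carrier G \<and> h \<in> carrier G"
  using gens_closed by (auto simp: cayley_edges_def)

lemma adjacent_translate:
  assumes "x \<in> carrier G" and "(g, h) \<in> adjacent"
  shows "(x \<otimes> g, x \<otimes> h) \<in> adjacent"
proof -
  have *: "(x \<otimes> g, x \<otimes> h) \<in> cayley_edges G S" if "(g, h) \<in> cayley_edges G S" for g h
  proof -
    from that obtain s where "g \<in> carrier G" "s \<in> S" "h = g \<otimes> s"
      by (auto simp: cayley_edges_def)
    moreover from this have "x \<otimes> h = (x \<otimes> g) \<otimes> s"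
      using assms(1) gens_closed by (auto simp: m_assoc)
    ultimately show ?thesis
      using assms(1) by (auto simp: cayley_edges_def)
  qed
  show ?thesis using assms(2) * by blast
qed

lemma path_translate:
  assumes "x \<in> carrier G" and "(g, h) \<in> adjacent ^^ n"
  shows "(x \<otimes> g, x \<otimes> h) \<in> adjacent ^^ n"
  using assms(2)
proof (induction n arbitrary: h)
  case (Suc n)
  then obtain y where "(g, y) \<in> adjacent ^^ n" "(y, h) \<in> adjacent" by auto
  with Suc.IH adjacent_translate[OF assms(1)] show ?case by (meson relpow_Suc_I)
qed simp

lemma path_reverse: "(g, h) \<in> adjacent ^^ n \<Longrightarrow> (h, g) \<in> adjacent ^^ n"
proof (induction n arbitrary: h)
  case (Suc n)
  then obtain y where "(g, y) \<in> adjacent ^^ n" "(y, h) \<in> adjacent" by auto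
  with Suc.IH have "(y, g) \<in> adjacent ^^ n" "(h, y) \<in> adjacent" by blast+
  then show ?case by (meson relpow_Suc_I2)
qed simp

lemma connected_by_path:
  assumes "g \<in> carrier G" and "h \<in> carrier G"
  shows "\<exists>n. (g, h) \<in> adjacent ^^ n"
proof -
  have "(x, x \<otimes> k) \<in> adjacent\<^sup>*" if "k \<in> generate G S" "x \<in> carrier G" for k x
    using that
  proof (induction arbitrary: x)
    case one
    then show ?case by simp
  next
    case (incl k)
    then have "(x, x \<otimes> k) \<in> cayley_edges G S" by (auto simp: cayley_edges_def)
    then show ?case by blast
  next
    case (inv k)
    then have "k \<in> carrier G" using gens_closed by blast
    with inv have "(x \<otimes> inv k, x) \<in> cayley_edges G S"
      by (force simp: cayley_edges_def m_assoc)
    then show ?case by blast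
  next
    case (eng k l)
    then have kl: "k \<in> carrier G" "l \<in> carrier G" using gens_generate by auto
    then have "(x \<otimes> k, (x \<otimes> k) \<otimes> l) \<in> adjacent\<^sup>*" using eng by blast
    with eng.IH(1)[OF eng.prems] kl eng.prems show ?case
      by (metis m_assoc rtrancl_trans)
  qed
  from this[of "inv g \<otimes> h" g] have "(g, g \<otimes> (inv g \<otimes> h)) \<in> adjacent\<^sup>*"
    using assms gens_generate by simp
  moreover have "g \<otimes> (inv g \<otimes> h) = h" using assms by (simp add: m_assoc[symmetric])
  ultimately show ?thesis using rtrancl_imp_relpow by metis
qed

lemma geodesic:
  "g \<in> carrier G \<Longrightarrow> h \<in> carrier G \<Longrightarrow> (g, h) \<in> adjacent ^^ word_dist G S g h"
  unfolding word_dist_def by (rule LeastI_ex) (rule connected_by_path)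

lemma word_dist_le_path: "(g, h) \<in> adjacent ^^ n \<Longrightarrow> word_dist G S g h \<le> n"
  unfolding word_dist_def by (rule Least_le)

lemma word_dist_refl [simp]: "word_dist G S g g = 0"
  using word_dist_le_path[of g g 0] by simp

lemma word_dist_commute:
  "g \<in> carrier G \<Longrightarrow> h \<in> carrier G \<Longrightarrow> word_dist G S g h = word_dist G S h g"
  by (meson geodesic le_antisym path_reverse word_dist_le_path)

lemma word_dist_triangle:
  assumes "g \<in> carrier G" "h \<in> carrier G" "k \<in> carrier G"
  shows "word_dist G S g k \<le> word_dist G S g h + word_dist G S h k"
proof (rule word_dist_le_path)
  show "(g, k) \<in> adjacent ^^ (word_dist G S g h + word_dist G S h k)"
    unfolding relpow_add using geodesic assms by blast
qed

lemma word_dist_translate_le: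
  assumes "x \<in> carrier G" "g \<in> carrier G" "h \<in> carrier G"
  shows "word_dist G S (x \<otimes> g) (x \<otimes> h) \<le> word_dist G S g h"
  using assms by (intro word_dist_le_path path_translate geodesic)

end

text \<open>
  Each edge is sent to a pair at distance at most \<open>c\<close>, because a homomorphism turns the edge
  \<open>(g, gs)\<close> into a translate of \<open>(1, f s)\<close> and there are finitely many \<open>s\<close>. Applied to the identity
  it compares two generating sets of one group.
\<close>

lemma hom_lipschitz:
  assumes X: "generating_set G X" and "finite X" and Y: "generating_set H Y"
    and f: "f \<in> hom G H"
  shows "\<exists>c. \<forall>g\<in>carrier G. \<forall>h\<in>carrier G.
           word_dist H Y (f g) (f h) \<le> c * word_dist G X g h"
proof -
  interpret X: generating_set G X by fact
  interpret Y: generating_set H Y by fact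
  define c where "c = (\<Sum>s\<in>X. word_dist H Y \<one>\<^bsub>H\<^esub> (f s))"
  have f_closed: "f g \<in> carrier H" if "g \<in> carrier G" for g
    using f that by (auto simp: hom_def)
  have edge: "word_dist H Y (f g) (f h) \<le> c" if "(g, h) \<in> cayley_edges G X" for g h
  proof -
    from that obtain s where s: "g \<in> carrier G" "s \<in> X" "h = g \<otimes>\<^bsub>G\<^esub> s"
      by (auto simp: cayley_edges_def)
    then have "f h = f g \<otimes>\<^bsub>H\<^esub> f s"
      using f X.gens_closed by (auto simp: hom_def)
    then have "word_dist H Y (f g) (f h) \<le> word_dist H Y \<one>\<^bsub>H\<^esub> (f s)"
      using Y.word_dist_translate_le[of "f g" "\<one>\<^bsub>H\<^esub>" "f s"] s f_closed X.gens_closed by auto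
    also have "\<dots> \<le> c"
      unfolding c_def using \<open>finite X\<close> s(2) by (intro member_le_sum) auto
    finally show ?thesis .
  qed
  have step: "word_dist H Y (f g) (f h) \<le> c" if "(g, h) \<in> X.adjacent" for g h
    using that edge edge[of h g] X.adjacent_closed[OF that] Y.word_dist_commute f_closed by auto
  have "word_dist H Y (f g) (f h) \<le> c * n"
    if "g \<in> carrier G" "h \<in> carrier G" "(g, h) \<in> X.adjacent ^^ n" for g h n
    using that
  proof (induction n arbitrary: h)
    case (Suc n)
    then obtain y where y: "(g, y) \<in> X.adjacent ^^ n" "(y, h) \<in> X.adjacent" by auto
    then have "y \<in> carrier G" using X.adjacent_closed by blast
    with Suc y have "word_dist H Y (f g) (f y) \<le> c * n" by blast
    with step[OF y(2)] Y.word_dist_triangle[of "f g" "f y" "f h"] \<open>y \<in> carrier G\<close> Suc.prems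
    show ?case by (simp add: f_closed)
  qed simp
  then show ?thesis using X.geodesic by blast
qed

section \<open>Words over a marked group\<close>

locale marked_group = group G for G (structure) +
  fixes A :: "'b set" and \<pi> :: "'b list \<Rightarrow> 'a"
  assumes marking: "\<pi> \<in> epi (free_monoid A) G"
begin

abbreviation d :: "'a \<Rightarrow> 'a \<Rightarrow> nat" where "d \<equiv> geod_dist G A \<pi>"

lemma marking_closed [simp]: "u \<in> lists A \<Longrightarrow> \<pi> u \<in> carrier G"
  using marking by (auto simp: epi_def hom_def free_monoid_def)

lemma marking_append: "u \<in> lists A \<Longrightarrow> v \<in> lists A \<Longrightarrow> \<pi> (u @ v) = \<pi> u \<otimes> \<pi> v"
  using marking by (auto simp: epi_def hom_def free_monoid_def)

lemma marking_Nil [simp]: "\<pi> [] = \<one>"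
proof -
  have "\<pi> [] \<otimes> \<pi> [] = \<pi> []" using marking_append[of "[]" "[]"] by simp
  then show ?thesis by (simp add: l_cancel_one)
qed

lemma take_in_lists: "u \<in> lists A \<Longrightarrow> take n u \<in> lists A"
  by (auto dest: in_set_takeD)

lemma prefix_closed [simp]: "u \<in> lists A \<Longrightarrow> \<pi> (take n u) \<in> carrier G"
  by (intro marking_closed take_in_lists)

end

sublocale marked_group \<subseteq> generating_set G "(\<lambda>a. \<pi> [a]) ` A"
proof
  show letters: "(\<lambda>a. \<pi> [a]) ` A \<subseteq> carrier G" by auto
  have "\<pi> u \<in> generate G ((\<lambda>a. \<pi> [a]) ` A)" if "u \<in> lists A" for u
    using that
  proof (induction u)
    case Nil
    then show ?case by (simp add: generate.one)
  next
    case (Cons a u)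
    then have "\<pi> (a # u) = \<pi> [a] \<otimes> \<pi> u" using marking_append[of "[a]" u] by simp
    with Cons show ?case by (auto intro: generate.eng generate.incl)
  qed
  moreover have "\<pi> ` lists A = carrier G"
    using marking by (simp add: epi_def free_monoid_def)
  ultimately have "carrier G \<subseteq> generate G ((\<lambda>a. \<pi> [a]) ` A)" by force
  with generate_incl[OF letters] show "generate G ((\<lambda>a. \<pi> [a]) ` A) = carrier G"
    by (rule equalityI)
qed

context marked_group
begin

lemmas d_refl [simp] = word_dist_refl[folded geod_dist_def[of G A \<pi>]]
lemmas d_commute = word_dist_commute[folded geod_dist_def[of G A \<pi>]]
lemmas d_triangle = word_dist_triangle[folded geod_dist_def[of G A \<pi>]]
lemmas d_geodesic = geodesic[folded geod_dist_def[of G A \<pi>]]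
lemmas d_le_path = word_dist_le_path[folded geod_dist_def[of G A \<pi>]]

lemma d_append_le:
  assumes "u \<in> lists A" "v \<in> lists A"
  shows "d (\<pi> u) (\<pi> (u @ v)) \<le> length v"
  using assms
proof (induction v arbitrary: u)
  case (Cons a v)
  have "(\<pi> u, \<pi> (u @ [a])) \<in> adjacent"
    using Cons.prems marking_append[of u "[a]"] by (auto simp: cayley_edges_def)
  then have "d (\<pi> u) (\<pi> (u @ [a])) \<le> 1" by (intro d_le_path) simp
  moreover have "d (\<pi> (u @ [a])) (\<pi> (u @ a # v)) \<le> length v"
    using Cons.IH[of "u @ [a]"] Cons.prems by simp
  moreover have "d (\<pi> u) (\<pi> (u @ a # v)) \<le>
      d (\<pi> u) (\<pi> (u @ [a])) + d (\<pi> (u @ [a])) (\<pi> (u @ a # v))"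
    using Cons.prems by (intro d_triangle marking_closed) auto
  ultimately show ?case by simp
qed simp

lemma d_prefixes_le:
  assumes "u \<in> lists A" and "m \<le> n + e" and "n \<le> m + e"
  shows "d (\<pi> (take m u)) (\<pi> (take n u)) \<le> e"
proof -
  have *: "d (\<pi> (take i u)) (\<pi> (take j u)) \<le> e" if "i \<le> j" "j \<le> i + e" for i j
  proof -
    have "take j u = take i u @ take (j - i) (drop i u)"
      using that(1) by (metis le_add_diff_inverse take_add)
    moreover have "take (j - i) (drop i u) \<in> lists A"
      using assms(1) by (meson in_listsD in_listsI in_set_dropD in_set_takeD)
    ultimately have "d (\<pi> (take i u)) (\<pi> (take j u)) \<le> length (take (j - i) (drop i u))"
      using d_append_le take_in_lists[OF assms(1)] by metis
    also have "\<dots> \<le> e" using that by simp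
    finally show ?thesis .
  qed
  have "d (\<pi> (take m u)) (\<pi> (take n u)) = d (\<pi> (take n u)) (\<pi> (take m u))"
    using assms(1) by (intro d_commute prefix_closed)
  with *[of m n] *[of n m] assms(2,3) show ?thesis by linarith
qed

end

section \<open>Rational languages\<close>

lemma rational_subset_lists: "rational A L \<Longrightarrow> L \<subseteq> lists A"
proof (induction rule: rational.induct)
  case (product K L)
  have "u @ v \<in> lists A" if "u \<in> K" "v \<in> L" for u v
    using subsetD[OF product.IH(1) that(1)] subsetD[OF product.IH(2) that(2)] by simp
  then show ?case by blast
next
  case (star K)
  have "concat us \<in> lists A" if "set us \<subseteq> K" for us
  proof -
    have "set us \<subseteq> lists A" using that star.IH by (rule subset_trans)
    then show ?thesis by (induction us) simp_all
  qed
  then show ?case by blast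
qed auto

text \<open>
  A rational language is accepted by a finite automaton, and from any state on an accepting path a
  final state can be reached in boundedly many steps; dually for initial states. Structural induction
  over rational expressions gives the same conclusion without constructing the automaton: a cut of
  a product or an iteration falls inside one factor, and it suffices to complete that factor (next to
  a short word of the other factor, in a product).
\<close>

lemma rational_short_completion:
  assumes "rational A L"
  shows "\<exists>C. \<forall>u v. u @ v \<in> L \<longrightarrow>
           (\<exists>w. length w \<le> C \<and> u @ w \<in> L) \<and> (\<exists>w. length w \<le> C \<and> w @ v \<in> L)"
  using assms
proof (induction rule: rational.induct)
  case empty
  then show ?case by simp
next
  case eps
  then show ?case by simp
next
  case (letter a)
  show ?case
  proof (intro exI[of _ 1] allI impI conjI)
    fix u v :: "'a list"
    assume "u @ v \<in> {[a]}"
    then have "u = [] \<and> v = [a] \<or> u = [a] \<and> v = []" by (simp add: append_eq_Cons_conv)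
    then show "\<exists>w. length w \<le> 1 \<and> u @ w \<in> {[a]}" "\<exists>w. length w \<le> 1 \<and> w @ v \<in> {[a]}"
      by auto
  qed
next
  case (union K L)
  then obtain C1 C2 where
    C1: "\<And>u v. u @ v \<in> K \<Longrightarrow>
           (\<exists>w. length w \<le> C1 \<and> u @ w \<in> K) \<and> (\<exists>w. length w \<le> C1 \<and> w @ v \<in> K)" and
    C2: "\<And>u v. u @ v \<in> L \<Longrightarrow>
           (\<exists>w. length w \<le> C2 \<and> u @ w \<in> L) \<and> (\<exists>w. length w \<le> C2 \<and> w @ v \<in> L)"
    by metis
  show ?case
  proof (intro exI[of _ "C1 + C2"] allI impI)
    fix u v assume "u @ v \<in> K \<union> L"
    then show "(\<exists>w. length w \<le> C1 + C2 \<and> u @ w \<in> K \<union> L) \<and>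
               (\<exists>w. length w \<le> C1 + C2 \<and> w @ v \<in> K \<union> L)"
      using C1[of u v] C2[of u v] by (meson UnE UnI1 UnI2 trans_le_add1 trans_le_add2)
  qed
next
  case (product K L)
  then obtain C1 C2 where
    C1: "\<And>u v. u @ v \<in> K \<Longrightarrow>
           (\<exists>w. length w \<le> C1 \<and> u @ w \<in> K) \<and> (\<exists>w. length w \<le> C1 \<and> w @ v \<in> K)" and
    C2: "\<And>u v. u @ v \<in> L \<Longrightarrow>
           (\<exists>w. length w \<le> C2 \<and> u @ w \<in> L) \<and> (\<exists>w. length w \<le> C2 \<and> w @ v \<in> L)"
    by metis
  let ?KL = "{u @ v | u v. u \<in> K \<and> v \<in> L}"
  show ?case
  proof (intro exI[of _ "C1 + C2"] allI impI)
    fix u v assume "u @ v \<in> ?KL"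
    then obtain k l where kl: "u @ v = k @ l" "k \<in> K" "l \<in> L" by blast
    \<comment> \<open>The empty prefix and suffix have short completions too, so both factors contain short words.\<close>
    obtain k0 l0 where k0: "length k0 \<le> C1" "k0 \<in> K" and l0: "length l0 \<le> C2" "l0 \<in> L"
      using C1[of "[]" k] C2[of "[]" l] kl by auto
    consider x where "k = u @ x" "v = x @ l" | x where "u = k @ x" "l = x @ v"
      using kl(1) by (auto simp: append_eq_append_conv2)
    then show "(\<exists>w. length w \<le> C1 + C2 \<and> u @ w \<in> ?KL) \<and> (\<exists>w. length w \<le> C1 + C2 \<and> w @ v \<in> ?KL)"
    proof cases
      case 1
      then obtain y z where y: "length y \<le> C1" "u @ y \<in> K" and z: "length z \<le> C1" "z @ x \<in> K"
        using C1[of u x] kl(2) by blast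
      have "u @ (y @ l0) \<in> ?KL" "z @ v \<in> ?KL"
        using y(2) l0(2) z(2) kl(3) 1(2) by (metis (mono_tags, lifting) CollectI append_assoc)+
      moreover have "length (y @ l0) \<le> C1 + C2" "length z \<le> C1 + C2"
        using y z l0 by simp_all
      ultimately show ?thesis by blast
    next
      case 2
      then obtain y z where y: "length y \<le> C2" "x @ y \<in> L" and z: "length z \<le> C2" "z @ v \<in> L"
        using C2[of x v] kl(3) by blast
      have "u @ y \<in> ?KL" "(k0 @ z) @ v \<in> ?KL"
        using y(2) k0(2) z(2) kl(2) 2(1) by (metis (mono_tags, lifting) CollectI append_assoc)+
      moreover have "length y \<le> C1 + C2" "length (k0 @ z) \<le> C1 + C2"
        using y z k0 by simp_all
      ultimately show ?thesis by blast
    qed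
  qed
next
  case (star K)
  then obtain C where
    C: "\<And>u v. u @ v \<in> K \<Longrightarrow>
          (\<exists>w. length w \<le> C \<and> u @ w \<in> K) \<and> (\<exists>w. length w \<le> C \<and> w @ v \<in> K)"
    by metis
  let ?K = "{concat us | us. set us \<subseteq> K}"
  show ?case
  proof (intro exI[of _ C] allI impI)
    fix u v assume "u @ v \<in> ?K"
    then obtain us where us: "concat us = u @ v" "set us \<subseteq> K" by auto
    show "(\<exists>w. length w \<le> C \<and> u @ w \<in> ?K) \<and> (\<exists>w. length w \<le> C \<and> w @ v \<in> ?K)"
    proof (cases "us = []")
      case True
      then have "u = []" "v = []" using us by auto
      moreover have "[] \<in> ?K" by (rule CollectI, rule exI[of _ "[]"]) simp
      ultimately show ?thesis by (intro conjI; intro exI[of _ "[]"]) simp_all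
    next
      case False
      then obtain as x y bs where
        split: "us = as @ (x @ y) # bs" "u = concat as @ x" "v = y @ concat bs"
        using us(1) by (auto simp: concat_eq_append_conv)
      then obtain w z where w: "length w \<le> C" "x @ w \<in> K" and z: "length z \<le> C" "z @ y \<in> K"
        using C[of x y] us(2) by auto
      have "u @ w \<in> ?K"
        by (rule CollectI, rule exI[of _ "as @ [x @ w]"]) (use split us(2) w in auto)
      moreover have "z @ v \<in> ?K"
        by (rule CollectI, rule exI[of _ "(z @ y) # bs"]) (use split us(2) z in auto)
      ultimately show ?thesis using w z by blast
    qed
  qed
qed

section \<open>Automatic structures\<close>

context marked_group
begin

text \<open>
  Since \<open>L\<close> represents every element, the vertices of a geodesic between the two endpoints have
  representatives in \<open>L\<close>, and the constant for adjacent endpoints accumulates along it. The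
  summand \<open>1\<close> accounts for distinct words with the same value.
\<close>

lemma automatic_fellow_travel:
  assumes "automatic_structure G A \<pi> L"
  shows "\<exists>N. \<forall>k. \<forall>u\<in>L. \<forall>v\<in>L. d (\<pi> u) (\<pi> v) \<le> k \<longrightarrow>
           (\<forall>n. d (\<pi> (take n u)) (\<pi> (take n v)) \<le> (k + 1) * N)"
proof -
  from assms obtain N where
    N: "\<And>u v n. u \<in> L \<Longrightarrow> v \<in> L \<Longrightarrow> d (\<pi> u) (\<pi> v) \<le> 1 \<Longrightarrow>
          d (\<pi> (take n u)) (\<pi> (take n v)) \<le> N"
    and onto: "\<pi> ` L = carrier G" and "rational A L"
    unfolding automatic_structure_def by blast
  then have L: "u \<in> lists A" if "u \<in> L" for u using rational_subset_lists that by blast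
  have path: "d (\<pi> (take n u)) (\<pi> (take n v)) \<le> (k + 1) * N"
    if "u \<in> L" "v \<in> L" "(\<pi> u, \<pi> v) \<in> adjacent ^^ k" for u v k n
    using that
  proof (induction k arbitrary: v)
    case 0
    then show ?case using N[of u v n] by simp
  next
    case (Suc k)
    then obtain y where y: "(\<pi> u, y) \<in> adjacent ^^ k" "(y, \<pi> v) \<in> adjacent" by auto
    then obtain x where x: "x \<in> L" "y = \<pi> x" using adjacent_closed onto by blast
    have "d (\<pi> x) (\<pi> v) \<le> 1" using y(2) x(2) by (intro d_le_path) simp
    then have "d (\<pi> (take n x)) (\<pi> (take n v)) \<le> N" using N x Suc.prems by blast
    moreover have "d (\<pi> (take n u)) (\<pi> (take n x)) \<le> (k + 1) * N"
      using Suc x y by blast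
    ultimately show ?case
      using d_triangle[of "\<pi> (take n u)" "\<pi> (take n x)" "\<pi> (take n v)"] L Suc.prems x by simp
  qed
  show ?thesis
  proof (intro exI[of _ N] allI ballI impI)
    fix k u v n assume uv: "u \<in> L" "v \<in> L" "d (\<pi> u) (\<pi> v) \<le> k"
    then have "d (\<pi> (take n u)) (\<pi> (take n v)) \<le> (d (\<pi> u) (\<pi> v) + 1) * N"
      by (intro path d_geodesic marking_closed L)
    also have "\<dots> \<le> (k + 1) * N" using uv(3) by simp
    finally show "d (\<pi> (take n u)) (\<pi> (take n v)) \<le> (k + 1) * N" .
  qed
qed

text \<open>
  Once \<open>v\<close> has ended, every later prefix of \<open>u\<close> stays within \<open>K\<close> of its endpoint, so \<open>u\<close> does not
  depart by more than \<open>2K\<close> from then on. The departure function allows this only for a bounded time.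
\<close>

lemma departure_length_diff:
  assumes D: "departure_function G A \<pi> L D" and "L \<subseteq> lists A"
  shows "\<exists>T. \<forall>u\<in>L. \<forall>v\<in>L. (\<forall>n. d (\<pi> (take n u)) (\<pi> (take n v)) \<le> K) \<longrightarrow>
           length u \<le> length v + T"
proof (intro exI ballI impI)
  let ?T = "nat \<lceil>D (real (2 * K))\<rceil>"
  fix u v assume uv: "u \<in> L" "v \<in> L" and ft: "\<forall>n. d (\<pi> (take n u)) (\<pi> (take n v)) \<le> K"
  show "length u \<le> length v + ?T"
  proof (rule ccontr)
    assume long: "\<not> length u \<le> length v + ?T"
    define s where "s = length u - ?T"
    have s: "s + ?T = length u" "length v \<le> s" using long by (auto simp: s_def)
    have uA: "u \<in> lists A" and vA: "v \<in> lists A" using uv assms(2) by auto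
    have "d (\<pi> (take s u)) (\<pi> v) \<le> K" "d (\<pi> u) (\<pi> v) \<le> K"
      using ft[rule_format, of s] ft[rule_format, of "length u"] s by simp_all
    then have "d (\<pi> (take s u)) (\<pi> u) \<le> 2 * K"
      using d_triangle[of "\<pi> (take s u)" "\<pi> v" "\<pi> u"] d_commute[of "\<pi> u" "\<pi> v"] uA vA by simp
    moreover have "real (d (\<pi> (take s u)) (\<pi> (take (s + ?T) u))) > real (2 * K)"
      using D uv(1) s(1) unfolding departure_function_def
      by (metis le_refl of_nat_0_le_iff real_nat_ceiling_ge)
    ultimately show False using s(1) by simp
  qed
qed

text \<open>
  This produces the input for the FT-BRP: up to bounded error, a word of \<open>L\<close> can be cut anywhere
  into two words of \<open>L\<close>. Without control of \<open>length u\<close> the two sides would still run along the same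
  suffix after the cut, but with an unbounded delay.
\<close>

lemma split_into_language_words:
  assumes aut: "automatic_structure G A \<pi> L" and D: "departure_function G A \<pi> L D"
  shows "\<exists>p::nat. \<forall>\<alpha>\<in>L. \<forall>n. \<exists>u\<in>L. \<exists>v\<in>L.
           MFT G A \<pi> (real p) (u @ v) \<alpha> \<and> d (\<pi> u) (\<pi> (take n \<alpha>)) \<le> p"
proof -
  from aut have rat: "rational A L" and onto: "\<pi> ` L = carrier G"
    unfolding automatic_structure_def by blast+
  have L: "u \<in> lists A" if "u \<in> L" for u using rational_subset_lists rat that by blast
  obtain C where C: "\<And>u v. u @ v \<in> L \<Longrightarrow>
      (\<exists>w. length w \<le> C \<and> u @ w \<in> L) \<and> (\<exists>w. length w \<le> C \<and> w @ v \<in> L)"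
    using rational_short_completion[OF rat] by metis
  obtain N where N: "\<And>k u v n. u \<in> L \<Longrightarrow> v \<in> L \<Longrightarrow> d (\<pi> u) (\<pi> v) \<le> k \<Longrightarrow>
      d (\<pi> (take n u)) (\<pi> (take n v)) \<le> (k + 1) * N"
    using automatic_fellow_travel[OF aut] by metis
  define K where "K = (2 * C + 1) * N"
  obtain T where T: "\<And>u v. u \<in> L \<Longrightarrow> v \<in> L \<Longrightarrow>
      (\<And>n. d (\<pi> (take n u)) (\<pi> (take n v)) \<le> K) \<Longrightarrow> length u \<le> length v + T"
    using departure_length_diff[OF D, of K] L by (metis subsetI)
  define E where "E = T + 2 * C"
  show ?thesis
  proof (intro exI[of _ "K + E"] ballI allI)
    fix \<alpha> n assume \<alpha>: "\<alpha> \<in> L"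
    define a where "a = take n \<alpha>"
    define b where "b = drop n \<alpha>"
    have ab: "\<alpha> = a @ b" by (simp add: a_def b_def)
    obtain w z where w: "length w \<le> C" "a @ w \<in> L" and z: "length z \<le> C" "z @ b \<in> L"
      using C[of a b] \<alpha> ab by blast
    have words: "a \<in> lists A" "b \<in> lists A" "w \<in> lists A" "z \<in> lists A"
      using L[OF w(2)] L[OF z(2)] by simp_all
    \<comment> \<open>The correction \<open>z\<close> must be undone by the first factor: an automatic structure
      compares words with a common start, so only the end of the first factor may be moved.\<close>
    obtain u where u: "u \<in> L" "\<pi> u = \<pi> a \<otimes> inv (\<pi> z)"
      using onto words by (metis imageE inv_closed m_closed marking_closed)
    have uA: "u \<in> lists A" using L u by blast
    have uz: "\<pi> (u @ z) = \<pi> a"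
      using u(2) uA words by (simp add: marking_append m_assoc)
    have "d (\<pi> u) (\<pi> a) \<le> C"
      using d_append_le[of u z] uA words uz z by simp
    moreover have "d (\<pi> a) (\<pi> (a @ w)) \<le> C"
      using d_append_le[of a w] words w by simp
    ultimately have "d (\<pi> u) (\<pi> (a @ w)) \<le> 2 * C"
      using d_triangle[of "\<pi> u" "\<pi> a" "\<pi> (a @ w)"] uA words by simp
    then have ft: "d (\<pi> (take m u)) (\<pi> (take m (a @ w))) \<le> K" for m
      unfolding K_def using N u(1) w(2) by blast
    then have ft': "d (\<pi> (take m (a @ w))) (\<pi> (take m u)) \<le> K" for m
      using d_commute uA words prefix_closed[of u m] prefix_closed[of "a @ w" m] by simp
    have len: "length u + length z \<le> length a + E" "length a \<le> length u + E"
      using T[OF u(1) w(2) ft] T[OF w(2) u(1) ft'] w(1) z(1) by (simp_all add: E_def)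
    have words': "u @ z @ b \<in> lists A" "a @ b \<in> lists A" using uA words by simp_all
    have mft: "d (\<pi> (take m (u @ z @ b))) (\<pi> (take m (a @ b))) \<le> K + E" for m
    proof (cases "m \<le> length a")
      case True
      then have "take m (a @ b) = take m (a @ w)" by simp
      then have "d (\<pi> (take m u)) (\<pi> (take m (a @ b))) \<le> K" using ft by metis
      moreover have "take m u = take (min m (length u)) (u @ z @ b)" by (simp add: min_def)
      then have "d (\<pi> (take m (u @ z @ b))) (\<pi> (take m u)) \<le> E"
        using d_prefixes_le[OF words'(1), of m "min m (length u)" E] True len(2) by simp
      ultimately show ?thesis
        using d_triangle[of "\<pi> (take m (u @ z @ b))" "\<pi> (take m u)" "\<pi> (take m (a @ b))"]
          words' uA prefix_closed by (smt (verit) add.commute add_mono le_trans)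
    next
      case False
      \<comment> \<open>Past the splitting point both words run along \<open>b\<close>, one with a bounded delay.\<close>
      define k where "k = m - length a"
      define j where "j = length u + length z + k"
      have "take m (a @ b) = a @ take k b" "take j (u @ z @ b) = (u @ z) @ take k b"
        using False by (simp_all add: k_def j_def)
      moreover have "take k b \<in> lists A" using words take_in_lists by blast
      ultimately have "\<pi> (take m (a @ b)) = \<pi> (take j (u @ z @ b))"
        using marking_append[of a "take k b"] marking_append[of "u @ z" "take k b"]
          uz words uA by simp
      moreover have "m \<le> j + E" "j \<le> m + E" using False len by (simp_all add: j_def k_def)
      ultimately show ?thesis using d_prefixes_le[OF words'(1), of m j E] by simp
    qed
    have "\<pi> (u @ z @ b) = \<pi> (a @ b)"
      using marking_append[of "u @ z" b] marking_append[of a b] uz uA words by simp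
    with mft have "MFT G A \<pi> (real (K + E)) (u @ (z @ b)) \<alpha>"
      unfolding MFT_def fellow_travel_def ab by (simp only: of_nat_le_iff simp_thms)
    moreover have "d (\<pi> u) (\<pi> (take n \<alpha>)) \<le> K + E"
      using \<open>d (\<pi> u) (\<pi> a) \<le> C\<close> by (simp add: a_def E_def)
    ultimately show "\<exists>u\<in>L. \<exists>v\<in>L. MFT G A \<pi> (real (K + E)) (u @ v) \<alpha> \<and>
        d (\<pi> u) (\<pi> (take n \<alpha>)) \<le> K + E"
      using u(1) z(2) by blast
  qed
qed

end

section \<open>Bounded reduction\<close>

text \<open>
  Times after the end of \<open>v\<close> are left out because \<open>\<beta>\<close> only passes near \<open>g\<close> and runs on, while \<open>v\<close>
  stops there.
\<close>

definition shadows ::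
  "('g, 'm) monoid_scheme \<Rightarrow> 'b set \<Rightarrow> ('b list \<Rightarrow> 'g) \<Rightarrow> nat \<Rightarrow> 'b list \<Rightarrow> 'g \<Rightarrow> 'b list \<Rightarrow> bool" where
  "shadows G B \<pi> M \<beta> g v \<longleftrightarrow>
     geod_dist G B \<pi> (\<pi> v) g \<le> M \<and>
     (\<forall>m\<le>length v. geod_dist G B \<pi> (\<pi> (take m v)) (\<pi> (take m \<beta>)) \<le> M)"

lemma shadows_mono: "shadows G B \<pi> M \<beta> g v \<Longrightarrow> M \<le> M' \<Longrightarrow> shadows G B \<pi> M' \<beta> g v"
  unfolding shadows_def by (meson le_trans)

text \<open>
  A word \<open>\<beta>\<close> stays near the points \<open>g i\<close> if its shadowing words form a chain with small steps, from
  a short word to one at least as long as \<open>\<beta>\<close>. The automatic structure is applied only to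
  neighbours in the chain; the shadowing property then transfers the estimate to \<open>\<beta>\<close>.
\<close>

lemma (in marked_group) chain_of_shadows:
  assumes aut: "automatic_structure G A \<pi> L"
  shows "\<exists>R. \<forall>\<beta>\<in>L. \<forall>l c g.
           (\<forall>i\<le>l. c i \<in> L \<and> g i \<in> carrier G \<and> shadows G A \<pi> M \<beta> (g i) (c i)) \<and>
           (\<forall>i<l. d (g i) (g (Suc i)) \<le> M) \<and> length (c 0) \<le> M \<and> length \<beta> \<le> length (c l) \<longrightarrow>
           (\<forall>m\<le>length \<beta>. \<exists>i\<le>l. d (g i) (\<pi> (take m \<beta>)) \<le> R)"
proof -
  from aut have "rational A L" unfolding automatic_structure_def by blast
  then have L: "u \<in> lists A" if "u \<in> L" for u using rational_subset_lists that by blast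
  obtain N where N: "\<And>k u v n. u \<in> L \<Longrightarrow> v \<in> L \<Longrightarrow> d (\<pi> u) (\<pi> v) \<le> k \<Longrightarrow>
      d (\<pi> (take n u)) (\<pi> (take n v)) \<le> (k + 1) * N"
    using automatic_fellow_travel[OF aut] by metis
  show ?thesis
  proof (rule exI[of _ "3 * M + (3 * M + 1) * N"], intro ballI allI impI, elim conjE)
    fix \<beta> l and c :: "nat \<Rightarrow> 'b list" and g m
    assume \<beta>: "\<beta> \<in> L"
      and chain: "\<forall>i\<le>l. c i \<in> L \<and> g i \<in> carrier G \<and> shadows G A \<pi> M \<beta> (g i) (c i)"
      and g_step: "\<forall>i<l. d (g i) (g (Suc i)) \<le> M"
      and start: "length (c 0) \<le> M" and finish: "length \<beta> \<le> length (c l)"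
      and m: "m \<le> length \<beta>"
    have cL: "c i \<in> L" "c i \<in> lists A" "g i \<in> carrier G" if "i \<le> l" for i
      using chain L that by blast+
    have end_near: "d (g i) (\<pi> (c i)) \<le> M" if "i \<le> l" for i
    proof -
      have "d (\<pi> (c i)) (g i) \<le> M" using chain that unfolding shadows_def by blast
      then show ?thesis using d_commute[of "g i" "\<pi> (c i)"] cL[OF that] by simp
    qed
    have travel: "d (\<pi> (take m (c i))) (\<pi> (take m \<beta>)) \<le> M" if "i \<le> l" "m \<le> length (c i)" for i
      using chain that unfolding shadows_def by blast
    \<comment> \<open>The first word of the chain that is still running at time \<open>m\<close>.\<close>
    define i where "i = (LEAST i. m \<le> length (c i))"
    have ex: "m \<le> length (c l)" using m finish by simp
    have i: "i \<le> l" "m \<le> length (c i)"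
      unfolding i_def using ex by (rule Least_le) (use ex in \<open>rule LeastI\<close>)
    show "\<exists>i\<le>l. d (g i) (\<pi> (take m \<beta>)) \<le> 3 * M + (3 * M + 1) * N"
    proof (cases i)
      case 0
      have "d (g 0) (\<pi> (c 0)) \<le> M" using end_near by simp
      moreover have "d (\<pi> (take (length (c 0)) (c 0))) (\<pi> (take m (c 0))) \<le> M"
        using cL[of 0] start i 0 by (intro d_prefixes_le) auto
      moreover have "d (\<pi> (take m (c 0))) (\<pi> (take m \<beta>)) \<le> M" using travel i 0 by simp
      moreover have "d (g 0) (\<pi> (take m \<beta>)) \<le> d (g 0) (\<pi> (c 0)) + d (\<pi> (c 0)) (\<pi> (take m \<beta>))"
        using cL[of 0] L[OF \<beta>] by (intro d_triangle) auto
      moreover have "d (\<pi> (c 0)) (\<pi> (take m \<beta>)) \<le>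
          d (\<pi> (c 0)) (\<pi> (take m (c 0))) + d (\<pi> (take m (c 0))) (\<pi> (take m \<beta>))"
        using cL[of 0] L[OF \<beta>] by (intro d_triangle) auto
      ultimately have "d (g 0) (\<pi> (take m \<beta>)) \<le> 3 * M + (3 * M + 1) * N"
        unfolding take_all[OF order_refl] by linarith
      then show ?thesis by blast
    next
      case (Suc j)
      have jl: "j < l" "j \<le> l" "Suc j \<le> l" using i Suc by simp_all
      have "\<not> m \<le> length (c j)" using not_less_Least[of j "\<lambda>i. m \<le> length (c i)"] Suc i_def by simp
      \<comment> \<open>The previous word has ended, so its prefix at time \<open>m\<close> is its endpoint.\<close>
      then have ended: "take m (c j) = c j" by simp
      note cj = cL[OF jl(2)] and cj' = cL[OF jl(3)]
      have "d (\<pi> (c j)) (g j) \<le> M" "d (g j) (g (Suc j)) \<le> M" "d (g (Suc j)) (\<pi> (c (Suc j))) \<le> M"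
        using chain jl g_step end_near unfolding shadows_def by blast+
      moreover have "d (\<pi> (c j)) (\<pi> (c (Suc j))) \<le> d (\<pi> (c j)) (g j) + d (g j) (\<pi> (c (Suc j)))"
        using cj cj' by (intro d_triangle) auto
      moreover have "d (g j) (\<pi> (c (Suc j))) \<le> d (g j) (g (Suc j)) + d (g (Suc j)) (\<pi> (c (Suc j)))"
        using cj cj' by (intro d_triangle) auto
      ultimately have "d (\<pi> (c j)) (\<pi> (c (Suc j))) \<le> 3 * M" by linarith
      then have "d (\<pi> (take m (c j))) (\<pi> (take m (c (Suc j)))) \<le> (3 * M + 1) * N"
        using cj cj' by (intro N)
      then have "d (\<pi> (c j)) (\<pi> (take m (c (Suc j)))) \<le> (3 * M + 1) * N" unfolding ended .
      moreover have "d (g j) (\<pi> (c j)) \<le> M" using end_near jl by blast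
      moreover have "d (\<pi> (take m (c (Suc j)))) (\<pi> (take m \<beta>)) \<le> M" using travel i Suc by simp
      moreover have "d (g j) (\<pi> (take m \<beta>)) \<le> d (g j) (\<pi> (c j)) + d (\<pi> (c j)) (\<pi> (take m \<beta>))"
        using cj L[OF \<beta>] by (intro d_triangle) auto
      moreover have "d (\<pi> (c j)) (\<pi> (take m \<beta>)) \<le>
          d (\<pi> (c j)) (\<pi> (take m (c (Suc j)))) + d (\<pi> (take m (c (Suc j)))) (\<pi> (take m \<beta>))"
        using cj cj' L[OF \<beta>] by (intro d_triangle) auto
      ultimately have "d (g j) (\<pi> (take m \<beta>)) \<le> 3 * M + (3 * M + 1) * N" by linarith
      then show ?thesis using jl by blast
    qed
  qed
qed

text \<open>
  The first factor of the image pair has the required properties: until it ends it coincides with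
  the product, which fellow travels with \<open>\<beta>\<close>.
\<close>

lemma shadowing_words_exist:
  assumes G1: "marked_group G A \<pi>\<^sub>1" and G2: "marked_group G B \<pi>\<^sub>2" and "finite A"
    and aut: "automatic_structure G A \<pi>\<^sub>1 L\<^sub>1" and D: "departure_function G A \<pi>\<^sub>1 L\<^sub>1 D"
    and aut2: "automatic_structure G B \<pi>\<^sub>2 L\<^sub>2"
    and \<phi>: "\<phi> \<in> hom G G" and ft: "FT_BRP G A \<pi>\<^sub>1 B \<pi>\<^sub>2 \<phi> L\<^sub>1 L\<^sub>2"
  shows "\<exists>M. \<forall>\<alpha>\<in>L\<^sub>1. \<forall>\<beta>\<in>L\<^sub>2. \<pi>\<^sub>2 \<beta> = \<phi> (\<pi>\<^sub>1 \<alpha>) \<longrightarrow>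
           (\<forall>n. \<exists>v\<in>L\<^sub>2. shadows G B \<pi>\<^sub>2 M \<beta> (\<phi> (\<pi>\<^sub>1 (take n \<alpha>))) v)"
proof -
  interpret G1: marked_group G A \<pi>\<^sub>1 by fact
  interpret G2: marked_group G B \<pi>\<^sub>2 by fact
  have rat: "rational A L\<^sub>1" using aut unfolding automatic_structure_def by blast
  have L1: "u \<in> lists A" if "u \<in> L\<^sub>1" for u using rational_subset_lists[OF rat] that by blast
  have onto2: "\<pi>\<^sub>2 ` L\<^sub>2 = carrier G" using aut2 unfolding automatic_structure_def by blast
  have \<phi>_closed: "\<phi> g \<in> carrier G" if "g \<in> carrier G" for g using \<phi> that by (auto simp: hom_def)
  obtain p :: nat where p: "\<And>\<alpha> n. \<alpha> \<in> L\<^sub>1 \<Longrightarrow> \<exists>u\<in>L\<^sub>1. \<exists>v\<in>L\<^sub>1.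
      MFT G A \<pi>\<^sub>1 (real p) (u @ v) \<alpha> \<and> G1.d (\<pi>\<^sub>1 u) (\<pi>\<^sub>1 (take n \<alpha>)) \<le> p"
    using G1.split_into_language_words[OF aut D] by metis
  have "\<exists>q\<ge>0. \<forall>u\<^sub>1\<in>L\<^sub>1. \<forall>u\<^sub>2\<in>L\<^sub>1. \<forall>u\<^sub>3\<in>L\<^sub>1. \<forall>v\<^sub>1\<in>L\<^sub>2. \<forall>v\<^sub>2\<in>L\<^sub>2. \<forall>v\<^sub>3\<in>L\<^sub>2.
        \<pi>\<^sub>2 v\<^sub>1 = \<phi> (\<pi>\<^sub>1 u\<^sub>1) \<and> \<pi>\<^sub>2 v\<^sub>2 = \<phi> (\<pi>\<^sub>1 u\<^sub>2) \<and> \<pi>\<^sub>2 v\<^sub>3 = \<phi> (\<pi>\<^sub>1 u\<^sub>3) \<and>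
        MFT G A \<pi>\<^sub>1 (real p) (u\<^sub>1 @ u\<^sub>2) u\<^sub>3 \<longrightarrow> MFT G B \<pi>\<^sub>2 q (v\<^sub>1 @ v\<^sub>2) v\<^sub>3"
    using ft of_nat_0_le_iff[of p] unfolding FT_BRP_def by blast
  then obtain q where q: "\<And>u\<^sub>1 u\<^sub>2 u\<^sub>3 v\<^sub>1 v\<^sub>2 v\<^sub>3. u\<^sub>1 \<in> L\<^sub>1 \<Longrightarrow> u\<^sub>2 \<in> L\<^sub>1 \<Longrightarrow> u\<^sub>3 \<in> L\<^sub>1 \<Longrightarrow>
      v\<^sub>1 \<in> L\<^sub>2 \<Longrightarrow> v\<^sub>2 \<in> L\<^sub>2 \<Longrightarrow> v\<^sub>3 \<in> L\<^sub>2 \<Longrightarrow>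
      \<pi>\<^sub>2 v\<^sub>1 = \<phi> (\<pi>\<^sub>1 u\<^sub>1) \<Longrightarrow> \<pi>\<^sub>2 v\<^sub>2 = \<phi> (\<pi>\<^sub>1 u\<^sub>2) \<Longrightarrow> \<pi>\<^sub>2 v\<^sub>3 = \<phi> (\<pi>\<^sub>1 u\<^sub>3) \<Longrightarrow>
      MFT G A \<pi>\<^sub>1 (real p) (u\<^sub>1 @ u\<^sub>2) u\<^sub>3 \<Longrightarrow> MFT G B \<pi>\<^sub>2 q (v\<^sub>1 @ v\<^sub>2) v\<^sub>3"
    by blast
  obtain c where c: "\<And>g h. g \<in> carrier G \<Longrightarrow> h \<in> carrier G \<Longrightarrow>
      G2.d (\<phi> g) (\<phi> h) \<le> c * G1.d g h"
    using hom_lipschitz[OF G1.generating_set_axioms _ G2.generating_set_axioms \<phi>] \<open>finite A\<close>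
    unfolding geod_dist_def by blast
  show ?thesis
  proof (intro exI[of _ "c * p + nat \<lceil>q\<rceil>"] ballI allI impI)
    fix \<alpha> \<beta> n assume \<alpha>: "\<alpha> \<in> L\<^sub>1" and \<beta>: "\<beta> \<in> L\<^sub>2" "\<pi>\<^sub>2 \<beta> = \<phi> (\<pi>\<^sub>1 \<alpha>)"
    obtain u\<^sub>1 u\<^sub>2 where u: "u\<^sub>1 \<in> L\<^sub>1" "u\<^sub>2 \<in> L\<^sub>1" "MFT G A \<pi>\<^sub>1 (real p) (u\<^sub>1 @ u\<^sub>2) \<alpha>"
      "G1.d (\<pi>\<^sub>1 u\<^sub>1) (\<pi>\<^sub>1 (take n \<alpha>)) \<le> p"
      using p[OF \<alpha>, of n] by blast
    have "\<phi> (\<pi>\<^sub>1 u\<^sub>1) \<in> \<pi>\<^sub>2 ` L\<^sub>2" "\<phi> (\<pi>\<^sub>1 u\<^sub>2) \<in> \<pi>\<^sub>2 ` L\<^sub>2"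
      using onto2 \<phi>_closed L1 u by simp_all
    then obtain v\<^sub>1 v\<^sub>2 where v: "v\<^sub>1 \<in> L\<^sub>2" "v\<^sub>2 \<in> L\<^sub>2" "\<pi>\<^sub>2 v\<^sub>1 = \<phi> (\<pi>\<^sub>1 u\<^sub>1)" "\<pi>\<^sub>2 v\<^sub>2 = \<phi> (\<pi>\<^sub>1 u\<^sub>2)"
      by (metis imageE)
    have "MFT G B \<pi>\<^sub>2 q (v\<^sub>1 @ v\<^sub>2) \<beta>" using q u v \<alpha> \<beta> by blast
    then have ft: "real (G2.d (\<pi>\<^sub>2 (take m (v\<^sub>1 @ v\<^sub>2))) (\<pi>\<^sub>2 (take m \<beta>))) \<le> q" for m
      unfolding MFT_def fellow_travel_def by blast
    have "G2.d (\<pi>\<^sub>2 (take m v\<^sub>1)) (\<pi>\<^sub>2 (take m \<beta>)) \<le> nat \<lceil>q\<rceil>" if "m \<le> length v\<^sub>1" for m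
      using ft[of m] that by (simp add: le_nat_iff) linarith
    moreover have "G2.d (\<pi>\<^sub>2 v\<^sub>1) (\<phi> (\<pi>\<^sub>1 (take n \<alpha>))) \<le> c * G1.d (\<pi>\<^sub>1 u\<^sub>1) (\<pi>\<^sub>1 (take n \<alpha>))"
      unfolding v(3) using L1 u(1) \<alpha> by (intro c) simp_all
    moreover have "c * G1.d (\<pi>\<^sub>1 u\<^sub>1) (\<pi>\<^sub>1 (take n \<alpha>)) \<le> c * p" using u(4) by simp
    ultimately have "shadows G B \<pi>\<^sub>2 (c * p + nat \<lceil>q\<rceil>) \<beta> (\<phi> (\<pi>\<^sub>1 (take n \<alpha>))) v\<^sub>1"
      unfolding shadows_def by (meson le_trans trans_le_add1 trans_le_add2)
    then show "\<exists>v\<in>L\<^sub>2. shadows G B \<pi>\<^sub>2 (c * p + nat \<lceil>q\<rceil>) \<beta> (\<phi> (\<pi>\<^sub>1 (take n \<alpha>))) v"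
      using v(1) by blast
  qed
qed

text \<open>
  Both halves of the Hausdorff estimate for \<open>x = 1\<close>, in the word metric of \<open>B\<close>.
\<close>

lemma images_uniformly_close:
  assumes G1: "marked_group G A \<pi>\<^sub>1" and G2: "marked_group G B \<pi>\<^sub>2" and "finite A"
    and aut: "automatic_structure G A \<pi>\<^sub>1 L\<^sub>1" and D: "departure_function G A \<pi>\<^sub>1 L\<^sub>1 D"
    and aut2: "automatic_structure G B \<pi>\<^sub>2 L\<^sub>2"
    and \<phi>: "\<phi> \<in> hom G G" and ft: "FT_BRP G A \<pi>\<^sub>1 B \<pi>\<^sub>2 \<phi> L\<^sub>1 L\<^sub>2"
  shows "\<exists>R. \<forall>\<alpha>\<in>L\<^sub>1. \<forall>\<beta>\<in>L\<^sub>2. \<pi>\<^sub>2 \<beta> = \<phi> (\<pi>\<^sub>1 \<alpha>) \<longrightarrow>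
     (\<forall>n. \<exists>m\<le>length \<beta>. geod_dist G B \<pi>\<^sub>2 (\<phi> (\<pi>\<^sub>1 (take n \<alpha>))) (\<pi>\<^sub>2 (take m \<beta>)) \<le> R) \<and>
     (\<forall>m\<le>length \<beta>. \<exists>n\<le>length \<alpha>. geod_dist G B \<pi>\<^sub>2 (\<phi> (\<pi>\<^sub>1 (take n \<alpha>))) (\<pi>\<^sub>2 (take m \<beta>)) \<le> R)"
proof -
  interpret G1: marked_group G A \<pi>\<^sub>1 by fact
  interpret G2: marked_group G B \<pi>\<^sub>2 by fact
  interpret \<phi>: group_hom G G \<phi> by unfold_locales fact
  have rat: "rational A L\<^sub>1" "rational B L\<^sub>2"
    using aut aut2 unfolding automatic_structure_def by blast+
  have L1: "u \<in> lists A" if "u \<in> L\<^sub>1" for u using rational_subset_lists[OF rat(1)] that by blast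
  have L2: "v \<in> lists B" if "v \<in> L\<^sub>2" for v using rational_subset_lists[OF rat(2)] that by blast
  obtain M where M: "\<And>\<alpha> \<beta> n. \<alpha> \<in> L\<^sub>1 \<Longrightarrow> \<beta> \<in> L\<^sub>2 \<Longrightarrow> \<pi>\<^sub>2 \<beta> = \<phi> (\<pi>\<^sub>1 \<alpha>) \<Longrightarrow>
      \<exists>v\<in>L\<^sub>2. shadows G B \<pi>\<^sub>2 M \<beta> (\<phi> (\<pi>\<^sub>1 (take n \<alpha>))) v"
    using shadowing_words_exist[OF assms] by metis
  obtain c where c: "\<And>g h. g \<in> carrier G \<Longrightarrow> h \<in> carrier G \<Longrightarrow>
      G2.d (\<phi> g) (\<phi> h) \<le> c * G1.d g h"
    using hom_lipschitz[OF G1.generating_set_axioms _ G2.generating_set_axioms \<phi>] \<open>finite A\<close>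
    unfolding geod_dist_def by blast
  obtain e where e: "e \<in> L\<^sub>2" "\<pi>\<^sub>2 e = \<one>\<^bsub>G\<^esub>"
    using aut2 G1.one_closed unfolding automatic_structure_def by (metis imageE)
  define M' where "M' = M + c + 2 * length e"
  obtain R where R: "\<And>\<beta> l c g m. \<beta> \<in> L\<^sub>2 \<Longrightarrow>
      (\<forall>i\<le>l. c i \<in> L\<^sub>2 \<and> g i \<in> carrier G \<and> shadows G B \<pi>\<^sub>2 M' \<beta> (g i) (c i)) \<Longrightarrow>
      (\<forall>i<l. G2.d (g i) (g (Suc i)) \<le> M') \<Longrightarrow> length (c 0) \<le> M' \<Longrightarrow> length \<beta> \<le> length (c l) \<Longrightarrow>
      m \<le> length \<beta> \<Longrightarrow> \<exists>i\<le>l. G2.d (g i) (\<pi>\<^sub>2 (take m \<beta>)) \<le> R"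
    using G2.chain_of_shadows[OF aut2, of M'] by metis
  show ?thesis
  proof (rule exI[of _ "2 * M + R"], intro ballI impI conjI allI)
    fix \<alpha> \<beta> n assume \<alpha>: "\<alpha> \<in> L\<^sub>1" and \<beta>: "\<beta> \<in> L\<^sub>2" "\<pi>\<^sub>2 \<beta> = \<phi> (\<pi>\<^sub>1 \<alpha>)"
    obtain v where v: "v \<in> L\<^sub>2" "shadows G B \<pi>\<^sub>2 M \<beta> (\<phi> (\<pi>\<^sub>1 (take n \<alpha>))) v"
      using M \<alpha> \<beta> by blast
    let ?g = "\<phi> (\<pi>\<^sub>1 (take n \<alpha>))" and ?b = "\<pi>\<^sub>2 (take (length v) \<beta>)"
    have "G2.d (\<pi>\<^sub>2 v) ?g \<le> M" "G2.d (\<pi>\<^sub>2 (take (length v) v)) ?b \<le> M"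
      using v(2) unfolding shadows_def by blast+
    moreover have "G2.d ?g (\<pi>\<^sub>2 v) = G2.d (\<pi>\<^sub>2 v) ?g"
      using L1[OF \<alpha>] L2[OF v(1)] by (intro G2.d_commute) simp_all
    moreover have "G2.d ?g ?b \<le> G2.d ?g (\<pi>\<^sub>2 v) + G2.d (\<pi>\<^sub>2 v) ?b"
      using L1[OF \<alpha>] L2[OF v(1)] L2[OF \<beta>(1)] by (intro G2.d_triangle) simp_all
    ultimately have "G2.d ?g ?b \<le> 2 * M + R" unfolding take_all[OF order_refl] by linarith
    moreover have "?b = \<pi>\<^sub>2 (take (min (length v) (length \<beta>)) \<beta>)" by (simp add: min_def)
    ultimately show "\<exists>m\<le>length \<beta>. G2.d ?g (\<pi>\<^sub>2 (take m \<beta>)) \<le> 2 * M + R"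
      by (metis min.cobounded2)
  next
    fix \<alpha> \<beta> m assume \<alpha>: "\<alpha> \<in> L\<^sub>1" and \<beta>: "\<beta> \<in> L\<^sub>2" "\<pi>\<^sub>2 \<beta> = \<phi> (\<pi>\<^sub>1 \<alpha>)" and m: "m \<le> length \<beta>"
    obtain V where V: "\<And>n. V n \<in> L\<^sub>2 \<and> shadows G B \<pi>\<^sub>2 M \<beta> (\<phi> (\<pi>\<^sub>1 (take n \<alpha>))) (V n)"
      using M[OF \<alpha> \<beta>] by metis
    \<comment> \<open>The chain: a fixed word \<open>e\<close> for the identity, then shadows for the proper prefixes of \<open>\<alpha>\<close>, then \<open>\<beta>\<close>.
      The index is shifted by one; for \<open>i = 0\<close> truncated subtraction gives the empty prefix, which
      matches \<open>e\<close>.\<close>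
    define g where "g i = \<phi> (\<pi>\<^sub>1 (take (i - 1) \<alpha>))" for i
    define w where "w i = (if i = 0 then e else if i \<le> length \<alpha> then V (i - 1) else \<beta>)" for i
    have "shadows G B \<pi>\<^sub>2 M' \<beta> (g i) (w i)" if i: "i \<le> Suc (length \<alpha>)" for i
    proof -
      consider "i = 0" | "1 \<le> i" "i \<le> length \<alpha>" | "i = Suc (length \<alpha>)" using i by linarith
      then show ?thesis
      proof cases
        case 1
        have "G2.d (\<pi>\<^sub>2 (take k e)) (\<pi>\<^sub>2 (take k \<beta>)) \<le> M'" if "k \<le> length e" for k
        proof -
          have "G2.d (\<pi>\<^sub>2 (take k e)) (\<pi>\<^sub>2 (take 0 e)) \<le> length e"
            "G2.d (\<pi>\<^sub>2 (take 0 \<beta>)) (\<pi>\<^sub>2 (take k \<beta>)) \<le> length e"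
            using L2 e \<beta> that by (intro G2.d_prefixes_le; simp)+
          moreover have "G2.d (\<pi>\<^sub>2 (take k e)) (\<pi>\<^sub>2 (take k \<beta>)) \<le>
              G2.d (\<pi>\<^sub>2 (take k e)) \<one>\<^bsub>G\<^esub> + G2.d \<one>\<^bsub>G\<^esub> (\<pi>\<^sub>2 (take k \<beta>))"
            using L2 e \<beta> by (intro G2.d_triangle) simp_all
          ultimately show ?thesis by (simp add: M'_def)
        qed
        then show ?thesis using 1 e by (simp add: shadows_def g_def w_def)
      next
        case 2
        then have "shadows G B \<pi>\<^sub>2 M \<beta> (g i) (w i)" using V by (simp add: g_def w_def)
        then show ?thesis by (rule shadows_mono) (simp add: M'_def)
      next
        case 3
        then show ?thesis using \<beta> by (simp add: shadows_def g_def w_def)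
      qed
    qed
    moreover have "w i \<in> L\<^sub>2" "g i \<in> carrier G" for i
      using e V \<beta> L1[OF \<alpha>] by (simp_all add: w_def g_def)
    moreover have "G2.d (g i) (g (Suc i)) \<le> M'" for i
    proof -
      have "G1.d (\<pi>\<^sub>1 (take (i - 1) \<alpha>)) (\<pi>\<^sub>1 (take i \<alpha>)) \<le> 1"
        using L1[OF \<alpha>] by (intro G1.d_prefixes_le) auto
      then have "c * G1.d (\<pi>\<^sub>1 (take (i - 1) \<alpha>)) (\<pi>\<^sub>1 (take i \<alpha>)) \<le> c * 1"
        by (rule mult_le_mono2)
      moreover have "G2.d (g i) (g (Suc i)) \<le> c * G1.d (\<pi>\<^sub>1 (take (i - 1) \<alpha>)) (\<pi>\<^sub>1 (take i \<alpha>))"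
        unfolding g_def diff_Suc_1 using L1[OF \<alpha>] by (intro c) simp_all
      ultimately show ?thesis unfolding M'_def by linarith
    qed
    ultimately have "\<exists>i\<le>Suc (length \<alpha>). G2.d (g i) (\<pi>\<^sub>2 (take m \<beta>)) \<le> R"
      using m by (intro R[where c = w] \<beta>) (auto simp: w_def M'_def)
    then obtain i where "i \<le> Suc (length \<alpha>)" "G2.d (g i) (\<pi>\<^sub>2 (take m \<beta>)) \<le> R" by blast
    moreover from this have "i - 1 \<le> length \<alpha>" by simp
    ultimately show "\<exists>n\<le>length \<alpha>. G2.d (\<phi> (\<pi>\<^sub>1 (take n \<alpha>))) (\<pi>\<^sub>2 (take m \<beta>)) \<le> 2 * M + R"
      unfolding g_def by (meson trans_le_add2)
  qed
qed

lemma hausdorff_dist_le: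
  assumes "\<And>x. x \<in> X \<Longrightarrow> \<exists>y\<in>Y. \<delta> x y \<le> N" and "\<And>y. y \<in> Y \<Longrightarrow> \<exists>x\<in>X. \<delta> x y \<le> N"
  shows "hausdorff_dist \<delta> X Y \<le> ereal N"
  unfolding hausdorff_dist_def
proof (intro max.boundedI SUP_least)
  fix x assume "x \<in> X"
  with assms(1) obtain y where "y \<in> Y" "\<delta> x y \<le> N" by blast
  then show "(INF y\<in>Y. ereal (\<delta> x y)) \<le> ereal N" by (intro INF_lower2) simp_all
next
  fix y assume "y \<in> Y"
  with assms(2) obtain x where "x \<in> X" "\<delta> x y \<le> N" by blast
  then show "(INF x\<in>X. ereal (\<delta> x y)) \<le> ereal N" by (intro INF_lower2) simp_all
qed

theorem proposition4p10:
  fixes G :: "('g, 'm) monoid_scheme"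
    and A :: "'a set" and \<pi>\<^sub>1 :: "'a list \<Rightarrow> 'g" and L\<^sub>1 :: "'a list set"
    and B :: "'b set" and \<pi>\<^sub>2 :: "'b list \<Rightarrow> 'g" and L\<^sub>2 :: "'b list set"
    and \<phi> :: "'g \<Rightarrow> 'g"
  assumes "group G"
    and "finite A" and "\<pi>\<^sub>1 \<in> epi (free_monoid A) G"
    and "automatic_structure G A \<pi>\<^sub>1 L\<^sub>1"
    and "\<exists>D. departure_function G A \<pi>\<^sub>1 L\<^sub>1 D"
    and "finite B" and "\<pi>\<^sub>2 \<in> epi (free_monoid B) G"
    and "automatic_structure G B \<pi>\<^sub>2 L\<^sub>2"
    and "\<phi> \<in> hom G G"
    and "FT_BRP G A \<pi>\<^sub>1 B \<pi>\<^sub>2 \<phi> L\<^sub>1 L\<^sub>2"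
  shows "BRP G \<pi>\<^sub>1 \<pi>\<^sub>2 \<phi> L\<^sub>1 L\<^sub>2"
proof -
  interpret G1: marked_group G A \<pi>\<^sub>1
    using assms(1,3) by (simp add: marked_group_def marked_group_axioms_def)
  interpret G2: marked_group G B \<pi>\<^sub>2
    using assms(1,7) by (simp add: marked_group_def marked_group_axioms_def)
  interpret \<phi>: group_hom G G \<phi> by unfold_locales fact
  have rat: "rational A L\<^sub>1" "rational B L\<^sub>2"
    using assms(4,8) unfolding automatic_structure_def by blast+
  obtain D where D: "departure_function G A \<pi>\<^sub>1 L\<^sub>1 D" using assms(5) by blast
  obtain R where R: "\<And>\<alpha> \<beta>. \<alpha> \<in> L\<^sub>1 \<Longrightarrow> \<beta> \<in> L\<^sub>2 \<Longrightarrow> \<pi>\<^sub>2 \<beta> = \<phi> (\<pi>\<^sub>1 \<alpha>) \<Longrightarrow>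
     (\<forall>n. \<exists>m\<le>length \<beta>. G2.d (\<phi> (\<pi>\<^sub>1 (take n \<alpha>))) (\<pi>\<^sub>2 (take m \<beta>)) \<le> R) \<and>
     (\<forall>m\<le>length \<beta>. \<exists>n\<le>length \<alpha>. G2.d (\<phi> (\<pi>\<^sub>1 (take n \<alpha>))) (\<pi>\<^sub>2 (take m \<beta>)) \<le> R)"
    using images_uniformly_close[OF G1.marked_group_axioms G2.marked_group_axioms
        assms(2,4) D assms(8,9,10)] by blast
  show ?thesis
    unfolding BRP_def
  proof (intro allI impI, elim conjE)
    fix S assume S: "finite S" "S \<subseteq> carrier G" "generate G S = carrier G"
    interpret S: generating_set G S by unfold_locales fact+
    have "(\<lambda>g. g) \<in> hom G G" by (simp add: hom_def)
    then obtain c where c: "\<And>g h. g \<in> carrier G \<Longrightarrow> h \<in> carrier G \<Longrightarrow>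
        word_dist G S g h \<le> c * G2.d g h"
      using hom_lipschitz[OF G2.generating_set_axioms _ S.generating_set_axioms] \<open>finite B\<close>
      unfolding geod_dist_def by blast
    have close: "real (word_dist G S (\<phi> (\<theta> G \<pi>\<^sub>1 x \<alpha> n)) (\<theta> G \<pi>\<^sub>2 (\<phi> x) \<beta> m)) \<le> real (c * R) + 1"
      if "x \<in> carrier G" "\<alpha> \<in> L\<^sub>1" "\<beta> \<in> L\<^sub>2" "G2.d (\<phi> (\<pi>\<^sub>1 (take n \<alpha>))) (\<pi>\<^sub>2 (take m \<beta>)) \<le> R"
      for x \<alpha> \<beta> n m
    proof -
      have words: "\<alpha> \<in> lists A" "\<beta> \<in> lists B"
        using that rational_subset_lists rat by blast+
      let ?g = "\<phi> (\<pi>\<^sub>1 (take n \<alpha>))" and ?h = "\<pi>\<^sub>2 (take m \<beta>)"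
      have gh: "?g \<in> carrier G" "?h \<in> carrier G" using words by simp_all
      have "word_dist G S (\<phi> (\<theta> G \<pi>\<^sub>1 x \<alpha> n)) (\<theta> G \<pi>\<^sub>2 (\<phi> x) \<beta> m) =
          word_dist G S (\<phi> x \<otimes>\<^bsub>G\<^esub> ?g) (\<phi> x \<otimes>\<^bsub>G\<^esub> ?h)"
        using that(1) words by (simp add: \<theta>_def)
      also have "\<dots> \<le> word_dist G S ?g ?h"
        using that(1) gh by (intro S.word_dist_translate_le) simp_all
      also have "\<dots> \<le> c * G2.d ?g ?h" using gh by (rule c)
      also have "\<dots> \<le> c * R" using that(4) by (rule mult_le_mono2)
      finally have "real (word_dist G S (\<phi> (\<theta> G \<pi>\<^sub>1 x \<alpha> n)) (\<theta> G \<pi>\<^sub>2 (\<phi> x) \<beta> m)) \<le> real (c * R)"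
        by (simp only: of_nat_le_iff)
      then show ?thesis by simp
    qed
    show "\<exists>N::real. N > 0 \<and>
         (\<forall>x\<in>carrier G. \<forall>\<alpha>\<in>L\<^sub>1. \<forall>\<beta>\<in>L\<^sub>2. \<pi>\<^sub>2 \<beta> = \<phi> (\<pi>\<^sub>1 \<alpha>) \<longrightarrow>
            hausdorff_dist (\<lambda>g h. real (word_dist G S g h))
              ((\<phi> \<circ> \<theta> G \<pi>\<^sub>1 x \<alpha>) ` {0..length \<alpha>}) (\<theta> G \<pi>\<^sub>2 (\<phi> x) \<beta> ` {0..length \<beta>}) \<le> ereal N)"
    proof (intro exI[of _ "real (c * R) + 1"] conjI ballI impI hausdorff_dist_le)
      fix x \<alpha> \<beta> y
      assume *: "x \<in> carrier G" "\<alpha> \<in> L\<^sub>1" "\<beta> \<in> L\<^sub>2" "\<pi>\<^sub>2 \<beta> = \<phi> (\<pi>\<^sub>1 \<alpha>)"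
        and "y \<in> (\<phi> \<circ> \<theta> G \<pi>\<^sub>1 x \<alpha>) ` {0..length \<alpha>}"
      then obtain n where y: "y = \<phi> (\<theta> G \<pi>\<^sub>1 x \<alpha> n)" by auto
      obtain m where m: "m \<le> length \<beta>" "G2.d (\<phi> (\<pi>\<^sub>1 (take n \<alpha>))) (\<pi>\<^sub>2 (take m \<beta>)) \<le> R"
        using R * by blast
      show "\<exists>z\<in>\<theta> G \<pi>\<^sub>2 (\<phi> x) \<beta> ` {0..length \<beta>}. real (word_dist G S y z) \<le> real (c * R) + 1"
        unfolding y using close[OF *(1-3) m(2)] m(1) by (intro bexI[rotated]) auto
    next
      fix x \<alpha> \<beta> z
      assume *: "x \<in> carrier G" "\<alpha> \<in> L\<^sub>1" "\<beta> \<in> L\<^sub>2" "\<pi>\<^sub>2 \<beta> = \<phi> (\<pi>\<^sub>1 \<alpha>)"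
        and "z \<in> \<theta> G \<pi>\<^sub>2 (\<phi> x) \<beta> ` {0..length \<beta>}"
      then obtain m where z: "z = \<theta> G \<pi>\<^sub>2 (\<phi> x) \<beta> m" "m \<le> length \<beta>" by auto
      obtain n where n: "n \<le> length \<alpha>" "G2.d (\<phi> (\<pi>\<^sub>1 (take n \<alpha>))) (\<pi>\<^sub>2 (take m \<beta>)) \<le> R"
        using R * z(2) by blast
      have "\<phi> (\<theta> G \<pi>\<^sub>1 x \<alpha> n) \<in> (\<phi> \<circ> \<theta> G \<pi>\<^sub>1 x \<alpha>) ` {0..length \<alpha>}" using n(1) by auto
      with close[OF *(1-3) n(2)] z(1)
      show "\<exists>y\<in>(\<phi> \<circ> \<theta> G \<pi>\<^sub>1 x \<alpha>) ` {0..length \<alpha>}. real (word_dist G S y z) \<le> real (c * R) + 1"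
        by blast
    qed (simp add: add_nonneg_pos)
  qed
qed

end
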